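(* Let $\mathcal{R}$ be a principal ideal ring and let $\mathcal{R}[x]=\mathcal{R}[x_1,\dots,x_N]$ with a fixed global monomial order $<$. Let $n\in\mathcal{R}$, $n\neq 0$, and let $I\subseteq\mathcal{R}[x]$ be an ideal. Assume that $G_n\subseteq\mathcal{R}[x]$ is a finite set of polynomials with the following properties: (1) $\pi_n(G_n)$ is a strong Gr\"obner basis of $\pi_n(I)\subseteq(\mathcal{R}/n\mathcal{R})[x]$; (2) for every $g\in G_n$ the leading coefficient $\mathrm{lc}(g)$ divides $n$ and $\mathrm{lc}(g)\notin n\mathcal{R}$. Then $G_n\cup\{n\}$ is a strong Gr\"obner basis of $I+n\mathcal{R}[x]$.
   Context: A principal ideal ring is a unital commutative ring in which every ideal is principal (not necessarily a domain). $\pi_n\colon\mathcal{R}\to\mathcal{R}/n\mathcal{R}$ is the canonical projection, and also denotes the induced coefficientwise map $\mathcal{R}[x]\to(\mathcal{R}/n\mathcal{R})[x]$. A monomial order is global if $x^\alpha\ge 1$ for all exponents $\alpha$; the same order is used over $\mathcal{R}$ and over $\mathcal{R}/n\mathcal{R}$. For a nonzero polynomial $f$, $\mathrm{lm}(f)$ is its largest monomial with respect to $<$, $\mathrm{lc}(f)$ the coefficient of that monomial (lead coefficient), and $\mathrm{lt}(f)=\mathrm{lc}(f)\,\mathrm{lm}(f)$ (lead term). In particular condition (2) implies that the elements of $G_n$ are nonzero. For a set $F$ of polynomials, $L(F)$ is the ideal generated by the $\mathrm{lt}(f)$ with $0\ne f\in F$. Over any principal ideal ring $S$, a finite subset $G\subset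 S[x]$ is a Gr\"obner basis of an ideal $J\subseteq S[x]$ if $G\subset J$ and $L(G)=L(J)$; it is a strong Gr\"obner basis of $J$ if moreover for every $f\in J\setminus\{0\}$ there is a nonzero $g\in G$ with $\mathrm{lt}(g)\mid\mathrm{lt}(f)$. *)

theory Defs
  imports "HOL-Algebra.QuotRing" "HOL-Algebra.Divisibility" "HOL-Library.Multiset"
begin

locale principal_ideal_ring = cring +
  assumes exists_gen: "ideal I R \<Longrightarrow> \<exists>a \<in> carrier R. I = PIdl a"

text \<open>
  A monomial in the variables \<open>x\<^sub>1, \<dots>, x\<^sub>N\<close> is a multiset over \<open>{1..N}\<close>; the exponent of \<open>x\<^sub>i\<close>
  is the multiplicity of \<open>i\<close>, the product of monomials is \<open>+\<close>, and the monomial \<open>1\<close> is \<open>{#}\<close>.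
  A polynomial over \<open>R\<close> is its coefficient function, equal to zero of \<open>R\<close> outside the monomials
  in these variables.
\<close>

definition monomials :: "nat \<Rightarrow> nat multiset set"
  where "monomials N = {m. set_mset m \<subseteq> {1..N}}"

definition supp :: "('a, 'b) ring_scheme \<Rightarrow> (nat multiset \<Rightarrow> 'a) \<Rightarrow> nat multiset set"
  where "supp R f = {m. f m \<noteq> \<zero>\<^bsub>R\<^esub>}"

definition term_poly :: "('a, 'b) ring_scheme \<Rightarrow> 'a \<Rightarrow> nat multiset \<Rightarrow> (nat multiset \<Rightarrow> 'a)"
  where "term_poly R a m = (\<lambda>k. if k = m then a else \<zero>\<^bsub>R\<^esub>)"

definition const_poly :: "('a, 'b) ring_scheme \<Rightarrow> 'a \<Rightarrow> (nat multiset \<Rightarrow> 'a)"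
  where "const_poly R a = term_poly R a {#}"

definition mpoly_ring :: "('a, 'b) ring_scheme \<Rightarrow> nat \<Rightarrow> (nat multiset \<Rightarrow> 'a) ring"
  where "mpoly_ring R N =
    \<lparr>carrier = {f. range f \<subseteq> carrier R \<and> finite (supp R f) \<and> supp R f \<subseteq> monomials N},
     monoid.mult = (\<lambda>f g m. \<Oplus>\<^bsub>R\<^esub>k\<in>{k. k \<subseteq># m}. f k \<otimes>\<^bsub>R\<^esub> g (m - k)),
     one = const_poly R \<one>\<^bsub>R\<^esub>,
     zero = (\<lambda>m. \<zero>\<^bsub>R\<^esub>),
     add = (\<lambda>f g m. f m \<oplus>\<^bsub>R\<^esub> g m)\<rparr>"

text \<open>Orders are given by their reflexive relation: \<open>(k, m) \<in> ord\<close> means \<open>k \<le> m\<close>.\<close>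

locale global_monomial_order =
  fixes N :: nat and ord :: "nat multiset rel"
  assumes linear: "linear_order_on (monomials N) ord"
    and mult_compatible: "\<lbrakk>(k, m) \<in> ord; l \<in> monomials N\<rbrakk> \<Longrightarrow> (k + l, m + l) \<in> ord"
    and global: "m \<in> monomials N \<Longrightarrow> ({#}, m) \<in> ord"

text \<open>
  \<open>lm\<close> is meaningful for nonzero polynomials only. The lead coefficient of the zero polynomial
  is zero regardless of the value of \<open>lm\<close>.
\<close>

definition lm :: "('a, 'b) ring_scheme \<Rightarrow> nat multiset rel \<Rightarrow> (nat multiset \<Rightarrow> 'a) \<Rightarrow> nat multiset"
  where "lm R ord f = (THE m. m \<in> supp R f \<and> (\<forall>k \<in> supp R f. (k, m) \<in> ord))"

definition lc :: "('a, 'b) ring_scheme \<Rightarrow> nat multiset rel \<Rightarrow> (nat multiset \<Rightarrow> 'a) \<Rightarrow> 'a"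
  where "lc R ord f = f (lm R ord f)"

definition lt :: "('a, 'b) ring_scheme \<Rightarrow> nat multiset rel \<Rightarrow> (nat multiset \<Rightarrow> 'a)
    \<Rightarrow> (nat multiset \<Rightarrow> 'a)"
  where "lt R ord f = term_poly R (lc R ord f) (lm R ord f)"

definition lead_ideal :: "('a, 'b) ring_scheme \<Rightarrow> nat \<Rightarrow> nat multiset rel
    \<Rightarrow> (nat multiset \<Rightarrow> 'a) set \<Rightarrow> (nat multiset \<Rightarrow> 'a) set"
  where "lead_ideal R N ord F =
    Idl\<^bsub>mpoly_ring R N\<^esub> (lt R ord ` (F - {\<zero>\<^bsub>mpoly_ring R N\<^esub>}))"

definition groebner_basis :: "('a, 'b) ring_scheme \<Rightarrow> nat \<Rightarrow> nat multiset rel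
    \<Rightarrow> (nat multiset \<Rightarrow> 'a) set \<Rightarrow> (nat multiset \<Rightarrow> 'a) set \<Rightarrow> bool"
  where "groebner_basis R N ord G J \<longleftrightarrow>
    ideal J (mpoly_ring R N) \<and> finite G \<and> G \<subseteq> J \<and>
    lead_ideal R N ord G = lead_ideal R N ord J"

definition strong_groebner_basis :: "('a, 'b) ring_scheme \<Rightarrow> nat \<Rightarrow> nat multiset rel
    \<Rightarrow> (nat multiset \<Rightarrow> 'a) set \<Rightarrow> (nat multiset \<Rightarrow> 'a) set \<Rightarrow> bool"
  where "strong_groebner_basis R N ord G J \<longleftrightarrow>
    groebner_basis R N ord G J \<and>
    (\<forall>f \<in> J - {\<zero>\<^bsub>mpoly_ring R N\<^esub>}. \<exists>g \<in> G - {\<zero>\<^bsub>mpoly_ring R N\<^esub>}.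
       lt R ord g divides\<^bsub>mpoly_ring R N\<^esub> lt R ord f)"

definition quot_ring :: "('a, 'b) ring_scheme \<Rightarrow> 'a \<Rightarrow> 'a set ring"
  where "quot_ring R n = R Quot (PIdl\<^bsub>R\<^esub> n)"

definition proj :: "('a, 'b) ring_scheme \<Rightarrow> 'a \<Rightarrow> 'a \<Rightarrow> 'a set"
  where "proj R n a = PIdl\<^bsub>R\<^esub> n +>\<^bsub>R\<^esub> a"

definition proj_poly :: "('a, 'b) ring_scheme \<Rightarrow> 'a \<Rightarrow> (nat multiset \<Rightarrow> 'a)
    \<Rightarrow> (nat multiset \<Rightarrow> 'a set)"
  where "proj_poly R n f = (\<lambda>m. proj R n (f m))"

end

theory Submission
  imports Defs
begin

text \<open>
  Modulo \<open>n\<close> the lead monomial of \<open>f\<close> can only change if \<open>lc f \<in> nR\<close>, and then \<open>lt f\<close> is a multiple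
  of \<open>n\<close>. Otherwise some \<open>lt (\<pi> g)\<close> divides \<open>lt (\<pi> f)\<close>, where \<open>\<pi>\<close> also preserves the lead monomial of
  \<open>g\<close>. Lifting the divisibility to \<open>R\<close> gives \<open>lc f = lc g \<cdot> c + n \<cdot> d\<close>, and \<open>lc g\<close> divides the error
  term because it divides \<open>n\<close>. Hence \<open>lt g\<close> divides \<open>lt f\<close>.
\<close>

text \<open>These are the index sets of the sums in the product of \<open>mpoly_ring\<close>.
  Finiteness lets a single summand be isolated, since a sum over an infinite set defaults to
  zero.\<close>

lemma finite_submultisets: "finite {k. k \<subseteq># m}"
proof (induction m)
  case (add x m)
  have "{k. k \<subseteq># add_mset x m} \<subseteq> {k. k \<subseteq># m} \<union> add_mset x ` {k. k \<subseteq># m}"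
  proof
    fix k assume k: "k \<in> {k. k \<subseteq># add_mset x m}"
    show "k \<in> {k. k \<subseteq># m} \<union> add_mset x ` {k. k \<subseteq># m}"
    proof (cases "x \<in># k")
      case True
      then obtain l where "k = add_mset x l" by (metis multi_member_split)
      with k show ?thesis by auto
    next
      case False
      have "count k y \<le> count m y" for y
        using k False mset_subset_eq_count[of k "add_mset x m" y]
        by (cases "y = x") (auto simp: not_in_iff)
      then show ?thesis by (simp add: subseteq_mset_def)
    qed
  qed
  with add show ?case by (meson finite_UnI finite_imageI finite_subset)
qed simp

section \<open>Lead monomials and lead terms under a global order\<close>

context global_monomial_order
begin

text \<open>Antisymmetry makes a greatest monomial of the support unique, so the \<open>THE\<close>
  in \<open>lm\<close> can be evaluated at any witness.\<close>

lemma lm_equality: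
  assumes "m \<in> supp R f" and "\<And>k. k \<in> supp R f \<Longrightarrow> (k, m) \<in> ord"
  shows "lm R ord f = m"
proof -
  have "antisym ord"
    using linear by (simp add: linear_order_on_def partial_order_on_def)
  then show ?thesis
    unfolding lm_def using assms by (intro the_equality) (auto dest: antisymD)
qed

lemma ex_greatest_monomial:
  assumes "finite A" and "A \<noteq> {}" and "A \<subseteq> monomials N"
  shows "\<exists>m\<in>A. \<forall>k\<in>A. (k, m) \<in> ord"
  using assms
proof (induction A rule: finite_ne_induct)
  case (singleton x)
  then show ?case
    using linear by (auto simp: linear_order_on_def partial_order_on_def preorder_on_def refl_on_def)
next
  case (insert x A)
  then obtain m where m: "m \<in> A" "\<forall>k\<in>A. (k, m) \<in> ord" by auto
  have x: "x \<in> monomials N" and m': "m \<in> monomials N" using insert m by auto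
  have refl: "(x, x) \<in> ord" and trans: "trans ord"
    using linear x
    by (auto simp: linear_order_on_def partial_order_on_def preorder_on_def refl_on_def)
  \<comment> \<open>Totality compares distinct monomials only; the case \<open>x = m\<close> rests
    on reflexivity.\<close>
  have "(x, m) \<in> ord \<or> (m, x) \<in> ord"
    using linear x m' refl by (cases "x = m") (auto simp: linear_order_on_def total_on_def)
  then show ?case
    using m refl trans by (metis insert_iff transD)
qed

lemma lm_greatest:
  assumes "f \<in> carrier (mpoly_ring R N)" and "f \<noteq> \<zero>\<^bsub>mpoly_ring R N\<^esub>"
  shows "lm R ord f \<in> supp R f" and "k \<in> supp R f \<Longrightarrow> (k, lm R ord f) \<in> ord"
proof -
  have "supp R f \<noteq> {}"
    using assms(2) by (auto simp: supp_def mpoly_ring_def)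
  then obtain m where m: "m \<in> supp R f" "\<forall>k\<in>supp R f. (k, m) \<in> ord"
    using ex_greatest_monomial[of "supp R f"] assms(1) by (auto simp: mpoly_ring_def)
  then have "lm R ord f = m" by (intro lm_equality) auto
  with m show "lm R ord f \<in> supp R f" "k \<in> supp R f \<Longrightarrow> (k, lm R ord f) \<in> ord" by auto
qed

lemma lt_const_poly:
  assumes "a \<noteq> \<zero>\<^bsub>R\<^esub>"
  shows "lt R ord (const_poly R a) = const_poly R a"
proof -
  have "lm R ord (const_poly R a) = {#}"
    \<comment> \<open>At \<open>{#}\<close>, globality is just the reflexivity
      \<open>({#}, {#}) \<in> ord\<close>, and \<open>{#}\<close> is the only monomial in the
      support.\<close>
    using assms global[of "{#}"]
    by (intro lm_equality) (auto simp: supp_def const_poly_def term_poly_def monomials_def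
      split: if_splits)
  then show ?thesis
    by (simp add: lt_def lc_def) (simp add: const_poly_def term_poly_def)
qed

end

section \<open>Arithmetic and divisibility of terms\<close>

context cring
begin

lemma term_poly_closed:
  "a \<in> carrier R \<Longrightarrow> m \<in> monomials N \<Longrightarrow> term_poly R a m \<in> carrier (mpoly_ring R N)"
  by (auto simp: mpoly_ring_def term_poly_def supp_def)

lemma const_poly_closed: "a \<in> carrier R \<Longrightarrow> const_poly R a \<in> carrier (mpoly_ring R N)"
  unfolding const_poly_def by (rule term_poly_closed) (auto simp: monomials_def)

lemma mpoly_coeff_closed: "f \<in> carrier (mpoly_ring R N) \<Longrightarrow> f m \<in> carrier R"
  by (auto simp: mpoly_ring_def)

text \<open>The substitution \<open>k \<mapsto> m - k\<close> is an involution on the divisors of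
  \<open>m\<close> and swaps the two factors of each summand.\<close>

lemma mpoly_mult_commute:
  assumes "f \<in> carrier (mpoly_ring R N)" and "g \<in> carrier (mpoly_ring R N)"
  shows "f \<otimes>\<^bsub>mpoly_ring R N\<^esub> g = g \<otimes>\<^bsub>mpoly_ring R N\<^esub> f"
proof
  fix m :: "nat multiset"
  note coeffs = assms[THEN mpoly_coeff_closed]
  have invol: "m - (m - k) = k" if "k \<subseteq># m" for k
    using that by (auto simp: multiset_eq_iff subseteq_mset_def)
  then have bij: "bij_betw (\<lambda>k. m - k) {k. k \<subseteq># m} {k. k \<subseteq># m}"
    by (intro bij_betw_byWitness[where f' = "\<lambda>k. m - k"]) auto
  have "(\<Oplus>k\<in>{k. k \<subseteq># m}. f k \<otimes> g (m - k))
      = (\<Oplus>k\<in>{k. k \<subseteq># m}. f (m - k) \<otimes> g (m - (m - k)))"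
    \<comment> \<open>The index set on the left is rewritten as its own image under the involution,
      so that reindexing applies.\<close>
    using bij coeffs
    by (subst (1) bij_betw_imp_surj_on[OF bij, symmetric], subst add.finprod_reindex)
      (auto simp: bij_betw_def)
  also have "\<dots> = (\<Oplus>k\<in>{k. k \<subseteq># m}. g k \<otimes> f (m - k))"
    using coeffs by (intro add.finprod_cong') (auto simp: m_comm invol)
  finally show "(f \<otimes>\<^bsub>mpoly_ring R N\<^esub> g) m = (g \<otimes>\<^bsub>mpoly_ring R N\<^esub> f) m"
    by (simp add: mpoly_ring_def)
qed

text \<open>Only the summand \<open>k = l\<close> of the convolution survives. This formula carries
  both directions of term divisibility.\<close>

lemma term_poly_mult:
  assumes "a \<in> carrier R" and "f \<in> carrier (mpoly_ring R N)"
  shows "(term_poly R a l \<otimes>\<^bsub>mpoly_ring R N\<^esub> f) m = (if l \<subseteq># m then a \<otimes> f (m - l) else \<zero>)"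
proof -
  note coeffs = mpoly_coeff_closed[OF assms(2)]
  have "(\<Oplus>k\<in>{k. k \<subseteq># m}. term_poly R a l k \<otimes> f (m - k)) =
      (\<Oplus>k\<in>{k. k \<subseteq># m}. if l = k then a \<otimes> f (m - k) else \<zero>)"
    using assms(1) coeffs by (intro add.finprod_cong') (auto simp: term_poly_def)
  also have "\<dots> = (if l \<subseteq># m then a \<otimes> f (m - l) else \<zero>)"
  proof (cases "l \<subseteq># m")
    case True
    then show ?thesis
      using finite_submultisets assms(1) coeffs
        add.finprod_singleton[of l "{k. k \<subseteq># m}" "\<lambda>k. a \<otimes> f (m - k)"] by auto
  next
    case False
    then have "(\<Oplus>k\<in>{k. k \<subseteq># m}. if l = k then a \<otimes> f (m - k) else \<zero>) = (\<Oplus>k\<in>{k. k \<subseteq># m}. \<zero>)"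
      by (intro add.finprod_cong') auto
    with False show ?thesis by simp
  qed
  finally show ?thesis by (simp add: mpoly_ring_def)
qed

lemma mult_const_poly:
  assumes "a \<in> carrier R" and "f \<in> carrier (mpoly_ring R N)"
  shows "(f \<otimes>\<^bsub>mpoly_ring R N\<^esub> const_poly R a) m = a \<otimes> f m"
  using assms term_poly_mult[OF assms, of "{#}" m]
  by (subst mpoly_mult_commute) (auto simp: const_poly_closed, simp add: const_poly_def)

lemma term_poly_divides:
  assumes "a \<in> carrier R" and "a divides b" and "l \<subseteq># m" and "m \<in> monomials N"
  shows "term_poly R a l divides\<^bsub>mpoly_ring R N\<^esub> term_poly R b m"
proof -
  obtain c where c: "c \<in> carrier R" "b = a \<otimes> c"
    using assms(2) by (auto simp: factor_def)
  have "m - l \<in> monomials N"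
    using assms(4) by (auto simp: monomials_def dest: in_diffD)
  with c have closed: "term_poly R c (m - l) \<in> carrier (mpoly_ring R N)"
    by (simp add: term_poly_closed)
  \<comment> \<open>The cofactor is the quotient of the coefficients times the quotient of the
    monomials.\<close>
  have "term_poly R b m = term_poly R a l \<otimes>\<^bsub>mpoly_ring R N\<^esub> term_poly R c (m - l)"
  proof
    fix k
    \<comment> \<open>Multiset subtraction truncates, so cancelling \<open>l\<close> requires it to
      be contained in both \<open>k\<close> and \<open>m\<close>.\<close>
    have "k - l = m - l \<longleftrightarrow> k = m" if "l \<subseteq># k"
      using that assms(3) by (metis subset_mset.diff_add)
    then show "term_poly R b m k = (term_poly R a l \<otimes>\<^bsub>mpoly_ring R N\<^esub> term_poly R c (m - l)) k"
      unfolding term_poly_mult[OF assms(1) closed]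
      using assms c by (auto simp: term_poly_def)
  qed
  with closed show ?thesis by (auto simp: factor_def)
qed

text \<open>Comparing coefficients at \<open>m\<close> suffices: there the product is zero unless
  \<open>l \<subseteq># m\<close>, and otherwise it is a multiple of \<open>a\<close>. The condition
  \<open>b \<noteq> \<zero>\<close> excludes the zero term, which every term divides whatever its
  monomial.\<close>

lemma term_poly_dividesD:
  assumes "a \<in> carrier R" and "b \<noteq> \<zero>"
    and "term_poly R a l divides\<^bsub>mpoly_ring R N\<^esub> term_poly R b m"
  shows "l \<subseteq># m" and "a divides b"
proof -
  obtain q where q: "q \<in> carrier (mpoly_ring R N)"
    "term_poly R b m = term_poly R a l \<otimes>\<^bsub>mpoly_ring R N\<^esub> q"
    using assms(3) by (auto simp: factor_def)
  have "b = term_poly R b m m" by (simp add: term_poly_def)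
  also have "\<dots> = (if l \<subseteq># m then a \<otimes> q (m - l) else \<zero>)"
    unfolding q(2) using term_poly_mult[OF assms(1) q(1)] .
  finally have b: "b = (if l \<subseteq># m then a \<otimes> q (m - l) else \<zero>)" .
  with assms(2) show "l \<subseteq># m" by (auto split: if_splits)
  with b mpoly_coeff_closed[OF q(1)] show "a divides b" by (auto simp: factor_def)
qed

section \<open>The quotient ring and the coefficientwise projection\<close>

lemma quot_ring_cring: "n \<in> carrier R \<Longrightarrow> cring (quot_ring R n)"
  unfolding quot_ring_def
  by (intro ideal.quotient_is_cring cgenideal_ideal is_cring)

lemma proj_closed: "a \<in> carrier R \<Longrightarrow> proj R n a \<in> carrier (quot_ring R n)"
  by (auto simp: quot_ring_def proj_def FactRing_def A_RCOSETS_def')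

lemma proj_hom: "n \<in> carrier R \<Longrightarrow> proj R n \<in> ring_hom R (quot_ring R n)"
  unfolding quot_ring_def proj_def[abs_def]
  by (rule ideal.rcos_ring_hom[OF cgenideal_ideal])

lemma proj_eq_iff:
  assumes "n \<in> carrier R" and "a \<in> carrier R" and "b \<in> carrier R"
  shows "proj R n a = proj R n b \<longleftrightarrow> a \<ominus> b \<in> PIdl n"
  unfolding proj_def
  using quotient_eq_iff_same_a_r_cos[OF cgenideal_ideal] assms by blast

lemma proj_zero_iff:
  assumes "n \<in> carrier R" and "a \<in> carrier R"
  shows "proj R n a = \<zero>\<^bsub>quot_ring R n\<^esub> \<longleftrightarrow> a \<in> PIdl n"
proof -
  have "proj R n \<zero> = \<zero>\<^bsub>quot_ring R n\<^esub>"
    using ring_hom_zero[OF proj_hom] quot_ring_cring assms(1) ring_axioms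
    by (blast dest: cring.axioms(1))
  then show ?thesis
    using proj_eq_iff[OF assms zero_closed] assms by (simp add: minus_eq)
qed

text \<open>With \<open>n = a \<otimes> d\<close>, a congruence
  \<open>b = a \<otimes> c \<oplus> e \<otimes> n\<close> becomes
  \<open>b = a \<otimes> (c \<oplus> d \<otimes> e)\<close>.\<close>

lemma proj_divides_imp_divides:
  assumes "n \<in> carrier R" and "a \<in> carrier R" and "b \<in> carrier R"
    and "a divides n" and "proj R n a divides\<^bsub>quot_ring R n\<^esub> proj R n b"
  shows "a divides b"
proof -
  obtain d where d: "d \<in> carrier R" "n = a \<otimes> d" using assms(4) by (auto simp: factor_def)
  \<comment> \<open>Every element of the quotient is a coset, so the cofactor has a representative
    in \<open>R\<close>.\<close>
  obtain c where c: "c \<in> carrier R" "proj R n b = proj R n a \<otimes>\<^bsub>quot_ring R n\<^esub> proj R n c"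
    using assms(5)
    by (auto simp: factor_def quot_ring_def proj_def FactRing_def A_RCOSETS_def')
  then have "proj R n b = proj R n (a \<otimes> c)"
    using ring_hom_mult[OF proj_hom] assms by metis
  then have "b \<ominus> a \<otimes> c \<in> PIdl n" using assms c by (simp add: proj_eq_iff)
  then obtain e where e: "e \<in> carrier R" "b \<ominus> a \<otimes> c = e \<otimes> n" by (auto simp: cgenideal_def)
  have "b = (b \<ominus> a \<otimes> c) \<oplus> a \<otimes> c" using assms c by algebra
  also have "\<dots> = a \<otimes> (c \<oplus> d \<otimes> e)" unfolding e(2) d(2) using assms c d e by algebra
  finally show ?thesis using c d e by (auto simp: factor_def)
qed

text \<open>The kernel of the projection consists of the multiples of the constant \<open>n\<close>:
  the coefficients of the difference are divided by \<open>n\<close> one by one. This later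
  identifies \<open>I + nR[x]\<close> with the preimage of the projected ideal.\<close>

lemma proj_poly_eq_iff:
  assumes "n \<in> carrier R"
    and f: "f \<in> carrier (mpoly_ring R N)" and g: "g \<in> carrier (mpoly_ring R N)"
  shows "proj_poly R n f = proj_poly R n g \<longleftrightarrow>
    (\<exists>h\<in>carrier (mpoly_ring R N).
       f = g \<oplus>\<^bsub>mpoly_ring R N\<^esub> (h \<otimes>\<^bsub>mpoly_ring R N\<^esub> const_poly R n))"
proof -
  note coeffs = f[THEN mpoly_coeff_closed] g[THEN mpoly_coeff_closed]
  have sum: "(g \<oplus>\<^bsub>mpoly_ring R N\<^esub> (h \<otimes>\<^bsub>mpoly_ring R N\<^esub> const_poly R n)) m = g m \<oplus> n \<otimes> h m"
    if "h \<in> carrier (mpoly_ring R N)" for h m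
    using mult_const_poly[OF assms(1) that, of m] by (simp add: mpoly_ring_def)
  show ?thesis
  proof
    assume "proj_poly R n f = proj_poly R n g"
    then have "f m \<ominus> g m \<in> PIdl n" for m
      using proj_eq_iff[OF assms(1)] coeffs by (auto simp: proj_poly_def dest: fun_cong)
    then have "\<forall>m. \<exists>c\<in>carrier R. f m \<ominus> g m = c \<otimes> n" by (auto simp: cgenideal_def)
    then obtain c where c: "\<And>m. c m \<in> carrier R" "\<And>m. f m \<ominus> g m = c m \<otimes> n" by metis
    \<comment> \<open>the choice of \<open>c m\<close> need not be zero where \<open>f\<close> and \<open>g\<close> both vanish\<close>
    define h where "h = (\<lambda>m. if m \<in> supp R f \<union> supp R g then c m else \<zero>)"
    have "supp R h \<subseteq> supp R f \<union> supp R g" by (auto simp: h_def supp_def)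
    then have h: "h \<in> carrier (mpoly_ring R N)"
      using f g c(1) by (auto simp: mpoly_ring_def h_def intro: finite_subset)
    have "f m = g m \<oplus> n \<otimes> h m" for m
    proof (cases "m \<in> supp R f \<union> supp R g")
      case True
      have "f m = g m \<oplus> (f m \<ominus> g m)" using coeffs[of m] by algebra
      with True c assms(1) show ?thesis by (simp add: h_def m_comm)
    next
      case False
      then show ?thesis using assms(1) by (simp add: h_def supp_def)
    qed
    with h sum show "\<exists>h\<in>carrier (mpoly_ring R N).
        f = g \<oplus>\<^bsub>mpoly_ring R N\<^esub> (h \<otimes>\<^bsub>mpoly_ring R N\<^esub> const_poly R n)"
      by (intro bexI[of _ h] ext) simp_all
  next
    assume "\<exists>h\<in>carrier (mpoly_ring R N).
        f = g \<oplus>\<^bsub>mpoly_ring R N\<^esub> (h \<otimes>\<^bsub>mpoly_ring R N\<^esub> const_poly R n)"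
    then obtain h where h: "h \<in> carrier (mpoly_ring R N)"
      "f = g \<oplus>\<^bsub>mpoly_ring R N\<^esub> (h \<otimes>\<^bsub>mpoly_ring R N\<^esub> const_poly R n)" by blast
    have "f m \<ominus> g m \<in> PIdl n" for m
    proof -
      note hm = mpoly_coeff_closed[OF h(1), of m]
      have "f m = g m \<oplus> n \<otimes> h m" using h sum by metis
      then have "f m \<ominus> g m = h m \<otimes> n" using coeffs(2)[of m] hm assms(1) by simp algebra
      with hm show ?thesis by (auto simp: cgenideal_def)
    qed
    then show "proj_poly R n f = proj_poly R n g"
      unfolding proj_poly_def using proj_eq_iff[OF assms(1) coeffs] by (intro ext) simp
  qed
qed

text \<open>Projecting can only shrink the support, and the lead coefficient survives because it
  lies outside \<open>nR\<close>.\<close>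

lemma lm_proj_poly:
  assumes "global_monomial_order N ord" and "n \<in> carrier R"
    and f: "f \<in> carrier (mpoly_ring R N)" and lc: "lc R ord f \<notin> PIdl n"
  shows "lm (quot_ring R n) ord (proj_poly R n f) = lm R ord f"
    and "lc (quot_ring R n) ord (proj_poly R n f) = proj R n (lc R ord f)"
proof -
  interpret global_monomial_order N ord by fact
  have zero: "\<zero> \<in> PIdl n"
    using assms(2) by (rule additive_subgroup.zero_closed[OF ideal.axioms(1)[OF cgenideal_ideal]])
  \<comment> \<open>The zero polynomial has lead coefficient zero whatever \<open>lm\<close>
    returns, and zero lies in \<open>nR\<close>.\<close>
  have f0: "f \<noteq> \<zero>\<^bsub>mpoly_ring R N\<^esub>"
    using lc zero by (auto simp: lc_def mpoly_ring_def)
  note coeffs = mpoly_coeff_closed[OF f]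
  have supp: "supp (quot_ring R n) (proj_poly R n f) = {m. f m \<notin> PIdl n}"
    using proj_zero_iff[OF assms(2) coeffs] by (auto simp: supp_def proj_poly_def)
  show lm: "lm (quot_ring R n) ord (proj_poly R n f) = lm R ord f"
  proof (rule lm_equality)
    show "lm R ord f \<in> supp (quot_ring R n) (proj_poly R n f)"
      using lc by (simp add: supp lc_def)
    fix k assume "k \<in> supp (quot_ring R n) (proj_poly R n f)"
    with zero have "k \<in> supp R f" by (auto simp: supp supp_def[of R])
    with f f0 show "(k, lm R ord f) \<in> ord" by (rule lm_greatest(2))
  qed
  then show "lc (quot_ring R n) ord (proj_poly R n f) = proj R n (lc R ord f)"
    by (simp add: lc_def proj_poly_def)
qed

end

section \<open>Lifting the strong Groebner basis from the quotient\<close>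

theorem theorem10:
  fixes R :: "('a, 'b) ring_scheme" (structure)
    and N :: nat and ord :: "nat multiset rel" and n :: 'a
    and I G :: "(nat multiset \<Rightarrow> 'a) set"
  assumes "principal_ideal_ring R"
    and "global_monomial_order N ord"
    and "n \<in> carrier R" and "n \<noteq> \<zero>"
    and "ideal I (mpoly_ring R N)"
    and "finite G" and "G \<subseteq> carrier (mpoly_ring R N)"
    and "strong_groebner_basis (quot_ring R n) N ord (proj_poly R n ` G) (proj_poly R n ` I)"
    and "\<And>g. g \<in> G \<Longrightarrow> lc R ord g divides n \<and> lc R ord g \<notin> PIdl n"
  shows "strong_groebner_basis R N ord (G \<union> {const_poly R n})
           (I <+>\<^bsub>mpoly_ring R N\<^esub> PIdl\<^bsub>mpoly_ring R N\<^esub> (const_poly R n))"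
proof -
  interpret principal_ideal_ring R by fact
  interpret order: global_monomial_order N ord by fact
  interpret Q: cring "quot_ring R n" using assms(3) by (rule quot_ring_cring)
  \<comment> \<open>the ring axioms for polynomials are part of the assumption that \<open>I\<close> is an ideal\<close>
  interpret P: ring "mpoly_ring R N" using assms(5) by (rule ideal.axioms(2))
  interpret P: cring "mpoly_ring R N"
    by unfold_locales (auto intro: mpoly_mult_commute)
  interpret I: ideal I "mpoly_ring R N" by fact
  let ?P = "mpoly_ring R N" and ?Q = "mpoly_ring (quot_ring R n) N"
  let ?n = "const_poly R n"
  let ?J = "I <+>\<^bsub>?P\<^esub> PIdl\<^bsub>?P\<^esub> ?n"
  note n = const_poly_closed[OF assms(3), of N]
  have PIdl_n: "ideal (PIdl\<^bsub>?P\<^esub> ?n) ?P" using n by (rule P.cgenideal_ideal)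
  have J: "ideal ?J ?P" using assms(5) PIdl_n by (rule P.add_ideals)
  \<comment> \<open>\<open>?J\<close> is the full preimage of the projected ideal, so membership can
    be tested modulo \<open>n\<close>. In particular it contains \<open>G\<close>, which need not
    lie in \<open>I\<close>.\<close>
  have J_iff: "f \<in> ?J \<longleftrightarrow> (\<exists>i\<in>I. proj_poly R n f = proj_poly R n i)" if "f \<in> carrier ?P" for f
    using that proj_poly_eq_iff[OF assms(3) that I.Icarr]
    by (auto simp: set_add_def' cgenideal_def)
  have G_J: "G \<union> {?n} \<subseteq> ?J"
  proof -
    have "g \<in> ?J" if "g \<in> G" for g
    proof -
      have "proj_poly R n g \<in> proj_poly R n ` I"
        using that assms(8) by (auto simp: strong_groebner_basis_def groebner_basis_def)
      with that assms(7) J_iff[of g] show ?thesis by auto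
    qed
    moreover have "?n = \<zero>\<^bsub>?P\<^esub> \<oplus>\<^bsub>?P\<^esub> \<one>\<^bsub>?P\<^esub> \<otimes>\<^bsub>?P\<^esub> ?n" using n by simp
    then have "?n \<in> ?J"
      unfolding set_add_def' cgenideal_def using I.zero_closed P.one_closed by blast
    ultimately show ?thesis by blast
  qed
  \<comment> \<open>The divisibility property comes first, since the equality of the lead ideals is
    derived from it.\<close>
  have strong: "\<exists>g \<in> (G \<union> {?n}) - {\<zero>\<^bsub>?P\<^esub>}. lt R ord g divides\<^bsub>?P\<^esub> lt R ord f"
    if f: "f \<in> ?J - {\<zero>\<^bsub>?P\<^esub>}" for f
  proof -
    have fc: "f \<in> carrier ?P" using f J by (auto dest: ideal.Icarr)
    have lm_f: "lm R ord f \<in> monomials N"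
      using order.lm_greatest(1)[OF fc] f fc by (auto simp: mpoly_ring_def)
    have lc_f: "lc R ord f \<in> carrier R" using mpoly_coeff_closed[OF fc] by (simp add: lc_def)
    show ?thesis
    proof (cases "lc R ord f \<in> PIdl n")
      case True
      then have "n divides lc R ord f" using assms(3) by (auto simp: cgenideal_def factor_def m_comm)
      then have "lt R ord ?n divides\<^bsub>?P\<^esub> lt R ord f"
        unfolding order.lt_const_poly[OF assms(4)]
        unfolding const_poly_def lt_def using assms(3) lm_f by (intro term_poly_divides) auto
      moreover have "?n {#} \<noteq> \<zero>\<^bsub>?P\<^esub> {#}"
        using assms(4) by (simp add: const_poly_def term_poly_def mpoly_ring_def)
      then have "?n \<noteq> \<zero>\<^bsub>?P\<^esub>" by auto
      ultimately show ?thesis by blast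
    next
      case False
      note proj_f = lm_proj_poly[OF assms(2,3) fc False]
      \<comment> \<open>This shows that the projection of \<open>f\<close> is nonzero, and it is
        also what allows monomial divisibility to be read off from term divisibility.\<close>
      have lc_proj_f: "proj R n (lc R ord f) \<noteq> \<zero>\<^bsub>quot_ring R n\<^esub>"
        using False proj_zero_iff[OF assms(3) lc_f] by simp
      have "proj_poly R n f \<noteq> \<zero>\<^bsub>?Q\<^esub>"
        using lc_proj_f by (auto simp: proj_poly_def mpoly_ring_def lc_def dest: fun_cong)
      moreover have "proj_poly R n f \<in> proj_poly R n ` I" using f J_iff[OF fc] by auto
      ultimately obtain g where g: "g \<in> G" and
        "lt (quot_ring R n) ord (proj_poly R n g) divides\<^bsub>?Q\<^esub> lt (quot_ring R n) ord (proj_poly R n f)"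
        using assms(8) by (auto simp: strong_groebner_basis_def)
      moreover have gc: "g \<in> carrier ?P" using g assms(7) by auto
      have lc_g: "lc R ord g \<in> carrier R" using mpoly_coeff_closed[OF gc] by (simp add: lc_def)
      ultimately have "term_poly (quot_ring R n) (proj R n (lc R ord g)) (lm R ord g) divides\<^bsub>?Q\<^esub>
          term_poly (quot_ring R n) (proj R n (lc R ord f)) (lm R ord f)"
        using assms(9) lm_proj_poly[OF assms(2,3) gc] proj_f by (simp add: lt_def)
      note div = Q.term_poly_dividesD[OF proj_closed[OF lc_g] lc_proj_f this]
      have "lc R ord g divides lc R ord f"
        using assms(3) lc_g lc_f conjunct1[OF assms(9)[OF g]] div(2)
        by (rule proj_divides_imp_divides)
      then have "lt R ord g divides\<^bsub>?P\<^esub> lt R ord f"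
        unfolding lt_def using lc_g div(1) lm_f by (simp add: term_poly_divides)
      moreover have "\<zero> \<in> PIdl n"
        using assms(3) by (rule additive_subgroup.zero_closed[OF ideal.axioms(1)[OF cgenideal_ideal]])
      then have "g \<noteq> \<zero>\<^bsub>?P\<^esub>" using assms(9)[OF g] by (auto simp: lc_def mpoly_ring_def)
      ultimately show ?thesis using g by blast
    qed
  qed
  \<comment> \<open>The facts about generated ideals require the generators to lie in the
    carrier.\<close>
  have lt_closed: "lt R ord ` (F - {\<zero>\<^bsub>?P\<^esub>}) \<subseteq> carrier ?P" if "F \<subseteq> carrier ?P" for F
  proof (rule image_subsetI)
    fix f assume "f \<in> F - {\<zero>\<^bsub>?P\<^esub>}"
    then have f: "f \<in> carrier ?P" "f \<noteq> \<zero>\<^bsub>?P\<^esub>" using that by auto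
    have "lm R ord f \<in> monomials N"
      using order.lm_greatest(1)[OF f] f(1) by (auto simp: mpoly_ring_def)
    with mpoly_coeff_closed[OF f(1)] show "lt R ord f \<in> carrier ?P"
      by (simp add: lt_def lc_def term_poly_closed)
  qed
  have J_carrier: "?J \<subseteq> carrier ?P" using J by (auto dest: ideal.Icarr)
  have G_carrier: "G \<union> {?n} \<subseteq> carrier ?P" using G_J J_carrier by (rule subset_trans)
  have "lead_ideal R N ord (G \<union> {?n}) = lead_ideal R N ord ?J"
  proof
    show "lead_ideal R N ord (G \<union> {?n}) \<subseteq> lead_ideal R N ord ?J"
      unfolding lead_ideal_def using G_J lt_closed[OF J_carrier]
      by (intro P.subset_Idl_subset) auto
    have L: "ideal (lead_ideal R N ord (G \<union> {?n})) ?P"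
      unfolding lead_ideal_def by (rule P.genideal_ideal[OF lt_closed[OF G_carrier]])
    \<comment> \<open>A multiple of a generator of an ideal lies in that ideal, so
      \<open>strong\<close> puts every generator of the larger lead ideal into the smaller
      one.\<close>
    have "lt R ord f \<in> lead_ideal R N ord (G \<union> {?n})" if f: "f \<in> ?J - {\<zero>\<^bsub>?P\<^esub>}" for f
    proof -
      obtain g where g: "g \<in> (G \<union> {?n}) - {\<zero>\<^bsub>?P\<^esub>}" "lt R ord g divides\<^bsub>?P\<^esub> lt R ord f"
        using strong[OF f] by blast
      have "lt R ord g \<in> lead_ideal R N ord (G \<union> {?n})"
        unfolding lead_ideal_def
        using P.genideal_self[OF lt_closed[OF G_carrier]] g(1) by blast
      with g(2) show ?thesis unfolding factor_def
        by (metis ideal.I_r_closed[OF L])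
    qed
    then show "lead_ideal R N ord ?J \<subseteq> lead_ideal R N ord (G \<union> {?n})"
      by (subst (1) lead_ideal_def) (intro P.genideal_minimal[OF L] image_subsetI)
  qed
  with J G_J assms(6) strong show ?thesis
    by (simp add: strong_groebner_basis_def groebner_basis_def)
qed

end
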